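(* Let $B$ be a nonzero left brace, let $(B,r)$ be its associated solution of the Yang--Baxter equation, and let $m$ be a positive integer. Then $(B,r)$ is a multipermutation solution of level $m$ (i.e. $\operatorname{mpl}(B,r)=m$) if and only if $B^{(m+1)}=0$ and $B^{(m)}\neq 0$.
   Context: A left brace is a set $B$ with two operations $+$ and $\cdot$ such that $(B,+)$ is an abelian group, $(B,\cdot)$ is a group, and $a\cdot(b+c)+a=a\cdot b+a\cdot c$ for all $a,b,c\in B$. Write $ab=a\cdot b$ and $a*b=ab-a-b$. For $a\in B$ let $\mathcal{L}_a\colon B\to B$, $\mathcal{L}_a(b)=ab-a$; each $\mathcal{L}_a$ is an automorphism of $(B,+)$. The brace is nonzero if $B\neq\{0\}$. For subsets $U,V$ of $B$, $U*V$ denotes the additive subgroup of $(B,+)$ generated by all $u*v$ with $u\in U$, $v\in V$. Rump's chain is $B^{(1)}=B$ and $B^{(n+1)}=B^{(n)}*B$ for $n\ge 1$. A solution of the Yang--Baxter equation is a pair $(X,r)$ with $X$ a non-empty set and $r\colon X\times X\to X\times X$, $r(x,y)=({}^{x}y,x^{y})$, such that $r_{12}r_{23}r_{12}=r_{23}r_{12}r_{23}$ on $X^3$ (where $r_{12}=r\times\mathrm{id}_X$, $r_{23}=\mathrm{id}_X\times r$), $r^2=\mathrm{id}$, and for every $x$ the maps $y\mapsto{}^{x}y$ and $y\mapsto y^{x}$ are bijective. The solution associated with a left brace $B$ is $(B,r)$ with $r(a,b)=(\mathcal{L}_a(b),\mathcal{L}^{-1}_{\mathcal{L}_a(b)}(a))$.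 For a solution $(X,r)$, define $x\sim y$ iff ${}^{x}z={}^{y}z$ for all $z\in X$. The retraction is the solution $\operatorname{Ret}(X,r)=([X],r_{[X]})$, where $[X]=X/{\sim}$, $[x]$ is the $\sim$-class of $x$, and $r_{[X]}([x],[y])=([{}^{x}y],[x^{y}])$. Put $\operatorname{Ret}^0(X,r)=(X,r)$, $\operatorname{Ret}^1(X,r)=\operatorname{Ret}(X,r)$ and $\operatorname{Ret}^k(X,r)=\operatorname{Ret}(\operatorname{Ret}^{k-1}(X,r))$ for $k>1$. The solution $(X,r)$ is a multipermutation solution of level $m$, written $\operatorname{mpl}(X,r)=m$, if $m$ is the smallest nonnegative integer such that $\operatorname{Ret}^m(X,r)$ has cardinality $1$. *)

theory Defs
  imports "HOL-Algebra.Generated_Groups" "HOL-Algebra.Ring" "HOL-Library.Disjoint_Sets"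
begin

section \<open>Left braces\<close>

text \<open>A left brace is carried by a ring record: the group \<open>(B,\<cdot>)\<close> is its monoid part and
  the abelian group \<open>(B,+)\<close> is its additive part. Full distributivity is not assumed.\<close>

locale left_brace = abelian_group B + group B for B (structure) +
  assumes brace_distrib:
    "\<lbrakk>a \<in> carrier B; b \<in> carrier B; c \<in> carrier B\<rbrakk>
      \<Longrightarrow> a \<otimes> (b \<oplus> c) \<oplus> a = a \<otimes> b \<oplus> a \<otimes> c"

definition brace_star :: "('a, 'b) ring_scheme \<Rightarrow> 'a \<Rightarrow> 'a \<Rightarrow> 'a" where
  "brace_star B a b = a \<otimes>\<^bsub>B\<^esub> b \<ominus>\<^bsub>B\<^esub> a \<ominus>\<^bsub>B\<^esub> b"

definition brace_L :: "('a, 'b) ring_scheme \<Rightarrow> 'a \<Rightarrow> 'a \<Rightarrow> 'a" where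
  "brace_L B a b = a \<otimes>\<^bsub>B\<^esub> b \<ominus>\<^bsub>B\<^esub> a"

definition star_subgroup :: "('a, 'b) ring_scheme \<Rightarrow> 'a set \<Rightarrow> 'a set \<Rightarrow> 'a set" where
  "star_subgroup B U V = generate (add_monoid B) {brace_star B u v | u v. u \<in> U \<and> v \<in> V}"

text \<open>The chain starts at index 1; the value at 0 is a dummy.\<close>

fun rump_chain :: "('a, 'b) ring_scheme \<Rightarrow> nat \<Rightarrow> 'a set" where
  "rump_chain B 0 = carrier B"
| "rump_chain B (Suc 0) = carrier B"
| "rump_chain B (Suc (Suc n)) = star_subgroup B (rump_chain B (Suc n)) (carrier B)"

section \<open>Solutions of the Yang--Baxter equation\<close>

text \<open>Only the values of the map on pairs from the underlying set are meaningful.\<close>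

type_synonym 'a pre_solution = "'a set \<times> ('a \<times> 'a \<Rightarrow> 'a \<times> 'a)"

definition r12 :: "('a \<times> 'a \<Rightarrow> 'a \<times> 'a) \<Rightarrow> 'a \<times> 'a \<times> 'a \<Rightarrow> 'a \<times> 'a \<times> 'a" where
  "r12 r = (\<lambda>(x, y, z). let (u, v) = r (x, y) in (u, v, z))"

definition r23 :: "('a \<times> 'a \<Rightarrow> 'a \<times> 'a) \<Rightarrow> 'a \<times> 'a \<times> 'a \<Rightarrow> 'a \<times> 'a \<times> 'a" where
  "r23 r = (\<lambda>(x, y, z). (x, r (y, z)))"

definition yb_solution :: "'a pre_solution \<Rightarrow> bool" where
  "yb_solution S \<longleftrightarrow> (case S of (X, r) \<Rightarrow>
     X \<noteq> {} \<and>
     r \<in> X \<times> X \<rightarrow> X \<times> X \<and>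
     (\<forall>t \<in> X \<times> X \<times> X. r12 r (r23 r (r12 r t)) = r23 r (r12 r (r23 r t))) \<and>
     (\<forall>p \<in> X \<times> X. r (r p) = p) \<and>
     (\<forall>x \<in> X. bij_betw (\<lambda>y. fst (r (x, y))) X X \<and> bij_betw (\<lambda>y. snd (r (y, x))) X X))"

definition brace_solution :: "('a, 'b) ring_scheme \<Rightarrow> 'a pre_solution" where
  "brace_solution B =
    (carrier B,
     \<lambda>(a, b). (brace_L B a b, inv_into (carrier B) (brace_L B (brace_L B a b)) a))"

section \<open>Retractions\<close>

definition ret_rel :: "'a pre_solution \<Rightarrow> ('a \<times> 'a) set" where
  "ret_rel S = (case S of (X, r) \<Rightarrow>
     {(x, y). x \<in> X \<and> y \<in> X \<and> (\<forall>z \<in> X. fst (r (x, z)) = fst (r (y, z)))})"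

definition ret_class :: "'a pre_solution \<Rightarrow> 'a \<Rightarrow> 'a set" where
  "ret_class S x = ret_rel S `` {x}"

text \<open>For classes \<open>U\<close> and \<open>V\<close>, the pair of classes of the components of \<open>r (x, y)\<close> is, for
  a solution, the same for all \<open>x \<in> U\<close> and \<open>y \<in> V\<close>; \<^const>\<open>the_elem\<close> picks this common value.\<close>

definition Ret :: "'a pre_solution \<Rightarrow> 'a set pre_solution" where
  "Ret S = (case S of (X, r) \<Rightarrow>
     (X // ret_rel S,
      \<lambda>(U, V). the_elem ((\<lambda>p. map_prod (ret_class S) (ret_class S) (r p)) ` (U \<times> V))))"

text \<open>Each application of \<^const>\<open>Ret\<close> raises the type by one level of sets, so it cannot be iterated
  as it stands. The iterates are therefore kept in type \<open>'a set\<close> by transporting along two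
  relabellings: \<open>x \<mapsto> {x}\<close> at the start, and \<open>\<Union>\<close> after every retraction, so that a class of
  subsets of \<open>X\<close> becomes a single subset of \<open>X\<close>. Both are injective on the sets concerned (see
  \<open>inj_on_Union_Ret_pow\<close> below), so the relabelled solutions are isomorphic copies.\<close>

definition transport :: "('a \<Rightarrow> 'b) \<Rightarrow> 'a pre_solution \<Rightarrow> 'b pre_solution" where
  "transport f S = (case S of (X, r) \<Rightarrow>
     (f ` X, \<lambda>(u, v). map_prod f f (r (inv_into X f u, inv_into X f v))))"

primrec Ret_pow :: "nat \<Rightarrow> 'a pre_solution \<Rightarrow> 'a set pre_solution" where
  "Ret_pow 0 S = transport (\<lambda>x. {x}) S"
| "Ret_pow (Suc k) S = transport Union (Ret (Ret_pow k S))"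

definition mpl_is :: "'a pre_solution \<Rightarrow> nat \<Rightarrow> bool" where
  "mpl_is S m \<longleftrightarrow> yb_solution S \<and> card (fst (Ret_pow m S)) = 1 \<and>
     (\<forall>k < m. card (fst (Ret_pow k S)) \<noteq> 1)"

lemma fst_transport [simp]: "fst (transport f S) = f ` fst S"
  by (simp add: transport_def split: prod.split)

lemma transport_iso:
  assumes "inj_on f (fst S)" "x \<in> fst S" "y \<in> fst S"
  shows "snd (transport f S) (f x, f y) = map_prod f f (snd S (x, y))"
  using assms by (auto simp: transport_def split: prod.split)

lemma equiv_ret_rel: "equiv (fst S) (ret_rel S)"
  by (cases S) (auto simp: ret_rel_def equiv_def refl_on_def sym_def trans_def)

lemma fst_Ret: "fst (Ret S) = fst S // ret_rel S"
  by (simp add: Ret_def split: prod.split)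

lemma inj_on_Union_disjoint:
  assumes "disjoint P" "{} \<notin> P"
  shows "inj_on Union (Pow P)"
proof (rule inj_onI)
  have *: "A \<subseteq> A'" if sub: "A \<subseteq> P" "A' \<subseteq> P" "\<Union>A \<subseteq> \<Union>A'" for A A'
  proof
    fix p assume p: "p \<in> A"
    have "p \<noteq> {}" using p sub(1) assms(2) by blast
    then obtain x where x: "x \<in> p" by blast
    with p sub(3) obtain q where q: "q \<in> A'" "x \<in> q" by blast
    have "p = q"
      using disjointD[OF assms(1), of p q] p q x sub(1,2) by blast
    with q show "p \<in> A'" by simp
  qed
  fix A A' assume "A \<in> Pow P" "A' \<in> Pow P" "\<Union>A = \<Union>A'"
  then show "A = A'" using *[of A A'] *[of A' A] by auto
qed

lemma partition_on_Ret_pow: "partition_on (fst S) (fst (Ret_pow k S))"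
proof (induction k)
  case 0
  show ?case by (auto simp: partition_on_def disjoint_def)
next
  case (Suc k)
  let ?P = "fst (Ret_pow k S)" and ?E = "ret_rel (Ret_pow k S)"
  have E: "equiv ?P ?E" by (rule equiv_ret_rel)
  have P: "disjoint ?P" "{} \<notin> ?P" "\<Union>?P = fst S"
    using Suc by (auto simp: partition_on_def)
  have sub: "A \<subseteq> ?P" if "A \<in> ?P // ?E" for A
    using that Union_quotient[OF E] by blast
  have d: "\<Union>A \<inter> \<Union>A' = {}"
    if "A \<in> ?P // ?E" "A' \<in> ?P // ?E" "\<Union>A \<noteq> \<Union>A'" for A A'
  proof -
    have AA: "A \<inter> A' = {}" using quotient_disj[OF E that(1,2)] that(3) by auto
    have "p \<inter> q = {}" if "p \<in> A" "q \<in> A'" for p q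
    proof (rule disjointD[OF P(1)])
      show "p \<in> ?P" "q \<in> ?P"
        using sub[OF \<open>A \<in> ?P // ?E\<close>] sub[OF \<open>A' \<in> ?P // ?E\<close>] that by auto
      show "p \<noteq> q" using AA that by auto
    qed
    then show ?thesis by auto
  qed
  have ne: "\<Union>A \<noteq> {}" if A: "A \<in> ?P // ?E" for A
  proof -
    obtain p where p: "p \<in> A" using in_quotient_imp_non_empty[OF E A] by auto
    then have "p \<noteq> {}" using sub[OF A] P(2) by auto
    then show ?thesis using p by auto
  qed
  have "\<Union>(Union ` Q) = \<Union>(\<Union>Q)" for Q :: "'a set set set"
    by auto
  then have un: "\<Union>(Union ` (?P // ?E)) = fst S"
    by (simp only: Union_quotient[OF E] P(3))
  show ?case
    unfolding Ret_pow.simps fst_transport fst_Ret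
  proof (rule partition_onI)
    show "\<Union>(Union ` (?P // ?E)) = fst S" by (rule un)
    show "disjnt p q"
      if pq: "p \<in> Union ` (?P // ?E)" "q \<in> Union ` (?P // ?E)" "p \<noteq> q" for p q
    proof -
      obtain A A' where "A \<in> ?P // ?E" "p = \<Union>A" "A' \<in> ?P // ?E" "q = \<Union>A'"
        using pq(1,2) by (elim imageE)
      then show ?thesis using d[of A A'] pq(3) unfolding disjnt_def by metis
    qed
    show "{} \<notin> Union ` (?P // ?E)"
    proof
      assume "{} \<in> Union ` (?P // ?E)"
      then obtain A where "A \<in> ?P // ?E" "{} = \<Union>A" by (elim imageE)
      with ne show False by metis
    qed
  qed
qed

lemma inj_on_Union_Ret_pow: "inj_on Union (fst (Ret (Ret_pow k S)))"
proof (rule inj_on_subset)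
  show "inj_on Union (Pow (fst (Ret_pow k S)))"
    using partition_on_Ret_pow[of S k] by (intro inj_on_Union_disjoint) (auto simp: partition_on_def)
  show "fst (Ret (Ret_pow k S)) \<subseteq> Pow (fst (Ret_pow k S))"
    unfolding fst_Ret using Union_quotient[OF equiv_ret_rel] by (metis Pow_iff Sup_upper subsetI)
qed

end

theory Submission
  imports Defs
begin

text \<open>
  Both sides of the equivalence describe the length of the upper socle series
  \<open>0 = Soc\<^sub>0 \<subseteq> Soc\<^sub>1 \<subseteq> \<dots>\<close>, where \<open>Soc\<^sub>k\<^sub>+\<^sub>1\<close> consists of the \<open>a\<close> with \<open>a * z \<in> Soc\<^sub>k\<close> for
  all \<open>z \<in> B\<close>. Each term is an ideal of the brace (\<open>brace_ideal_socle_over\<close>).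

  On the side of the solution, the \<open>k\<close>-th retraction is the set of cosets of \<open>Soc\<^sub>k\<close> with the
  induced map (\<open>Ret_pow_brace_solution\<close>): the cosets of \<open>x\<close> and \<open>y\<close> act in the same way exactly if
  \<open>L\<^sub>x(z) - L\<^sub>y(z) \<in> Soc\<^sub>k\<close> for all \<open>z\<close>, and this says \<open>x - y \<in> Soc\<^sub>k\<^sub>+\<^sub>1\<close>
  (\<open>L_diff_in_ideal_iff\<close>). Hence the \<open>k\<close>-th retraction is a point if and only if
  \<open>Soc\<^sub>k = B\<close>.

  On the side of Rump's chain, \<open>Soc\<^sub>i\<close> is an additive subgroup, so \<open>U * B \<subseteq> Soc\<^sub>i\<close> if and only if
  \<open>U \<subseteq> Soc\<^sub>i\<^sub>+\<^sub>1\<close>. Moving the factors \<open>B\<close> to the other side one at a time turns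
  \<open>B\<^sup>(\<^sup>k\<^sup>+\<^sup>1\<^sup>) \<subseteq> Soc\<^sub>0\<close> into \<open>B \<subseteq> Soc\<^sub>k\<close> (\<open>rump_chain_eq_zero_iff\<close>).

  A multipermutation solution is in particular a solution, so the proof also contains the fact
  that the associated pair solves the Yang--Baxter equation (\<open>yb_solution_brace_solution\<close>).
\<close>

section \<open>Arithmetic in a left brace\<close>

context left_brace
begin

abbreviation L :: "'a \<Rightarrow> 'a \<Rightarrow> 'a" where
  "L \<equiv> brace_L B"

abbreviation star :: "'a \<Rightarrow> 'a \<Rightarrow> 'a" where
  "star \<equiv> brace_star B"

lemma one_eq_zero: "\<one> = \<zero>"
proof -
  have "\<one> \<otimes> (\<zero> \<oplus> \<zero>) \<oplus> \<one> = \<one> \<otimes> \<zero> \<oplus> \<one> \<otimes> \<zero>"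
    by (rule brace_distrib) auto
  then show ?thesis by simp
qed

lemma L_closed [simp]: "a \<in> carrier B \<Longrightarrow> b \<in> carrier B \<Longrightarrow> L a b \<in> carrier B"
  by (simp add: brace_L_def)

lemma star_closed [simp]: "a \<in> carrier B \<Longrightarrow> b \<in> carrier B \<Longrightarrow> star a b \<in> carrier B"
  by (simp add: brace_star_def)

lemma mult_eq_add_L:
  assumes "a \<in> carrier B" "b \<in> carrier B"
  shows "a \<otimes> b = a \<oplus> L a b"
  using assms by (simp add: brace_L_def minus_eq a_ac r_neg r_neg1 r_neg2)

lemma star_eq_L:
  assumes "a \<in> carrier B" "b \<in> carrier B"
  shows "star a b = L a b \<ominus> b"
  using assms by (simp add: brace_L_def brace_star_def)

lemma L_add:
  assumes "a \<in> carrier B" "b \<in> carrier B" "c \<in> carrier B"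
  shows "L a (b \<oplus> c) = L a b \<oplus> L a c"
proof -
  have "a \<oplus> (a \<oplus> L a (b \<oplus> c)) = a \<oplus> (a \<oplus> (L a b \<oplus> L a c))"
    using brace_distrib[OF assms] assms by (simp add: mult_eq_add_L a_ac)
  then show ?thesis using assms by simp
qed

lemma L_one [simp]: "a \<in> carrier B \<Longrightarrow> L \<zero> a = a"
  using mult_eq_add_L[of \<zero> a] l_one[of a] by (simp add: one_eq_zero)

lemma L_one' [simp]: "a \<in> carrier B \<Longrightarrow> L \<one> a = a"
  by (simp add: one_eq_zero)

lemma L_zero [simp]: "a \<in> carrier B \<Longrightarrow> L a \<zero> = \<zero>"
  using L_add[of a \<zero> \<zero>] by simp

lemma L_mult:
  assumes "a \<in> carrier B" "b \<in> carrier B" "c \<in> carrier B"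
  shows "L (a \<otimes> b) c = L a (L b c)"
proof -
  have "a \<otimes> b \<oplus> L (a \<otimes> b) c = a \<otimes> (b \<otimes> c)"
    using assms by (simp add: mult_eq_add_L[symmetric] m_assoc)
  also have "\<dots> = a \<otimes> b \<oplus> L a (L b c)"
    using assms by (simp add: mult_eq_add_L L_add a_ac)
  finally show ?thesis using assms by simp
qed

lemma L_inv [simp]:
  assumes "a \<in> carrier B" "b \<in> carrier B"
  shows "L (inv a) (L a b) = b" "L a (L (inv a) b) = b"
  using assms by (simp_all add: L_mult[symmetric] one_eq_zero)

lemma L_minus:
  assumes "a \<in> carrier B" "b \<in> carrier B"
  shows "L a (\<ominus> b) = \<ominus> L a b"
  using L_add[of a b "\<ominus> b"] assms by (metis L_closed L_zero a_inv_closed minus_equality a_comm r_neg)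

lemma L_diff:
  assumes "a \<in> carrier B" "b \<in> carrier B" "c \<in> carrier B"
  shows "L a (b \<ominus> c) = L a b \<ominus> L a c"
  using assms by (simp add: minus_eq L_add L_minus)

lemma L_inv_self:
  assumes "a \<in> carrier B"
  shows "L a (inv a) = \<ominus> a"
  using mult_eq_add_L[of a "inv a"] assms by (metis L_closed inv_closed minus_equality a_comm r_inv one_eq_zero)

text \<open>Sums become products, which is how closure under addition is later deduced from closure
  under multiplication and under all \<open>L c\<close>.\<close>

lemma add_eq_mult_L:
  assumes "a \<in> carrier B" "b \<in> carrier B"
  shows "a \<oplus> b = a \<otimes> L (inv a) b"
  using assms by (simp add: mult_eq_add_L)

lemma diff_add_diff:
  assumes "a \<in> carrier B" "b \<in> carrier B" "c \<in> carrier B"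
  shows "(a \<ominus> b) \<oplus> (b \<ominus> c) = a \<ominus> c"
  using assms by (simp add: minus_eq a_assoc r_neg1)

lemma diff_self [simp]: "a \<in> carrier B \<Longrightarrow> a \<ominus> a = \<zero>"
  by (simp add: minus_eq r_neg)

lemma diff_zero [simp]: "a \<in> carrier B \<Longrightarrow> a \<ominus> \<zero> = a"
  by (simp add: minus_eq)

lemma minus_diff:
  assumes "a \<in> carrier B" "b \<in> carrier B"
  shows "\<ominus> (a \<ominus> b) = b \<ominus> a"
  using assms by (simp add: minus_eq minus_add a_comm)

lemma diff_eq_zero_iff:
  assumes "a \<in> carrier B" "b \<in> carrier B"
  shows "a \<ominus> b = \<zero> \<longleftrightarrow> a = b"
  using assms by (metis diff_self diff_add_diff diff_zero minus_diff l_zero a_inv_closed minus_closed minus_minus zero_closed)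

lemma star_mult:
  assumes "a \<in> carrier B" "b \<in> carrier B" "z \<in> carrier B"
  shows "star (a \<otimes> b) z = star a (L b z) \<oplus> star b z"
  using assms by (simp add: star_eq_L L_mult diff_add_diff)

lemma star_inv:
  assumes "a \<in> carrier B" "z \<in> carrier B"
  shows "star (inv a) z = \<ominus> star a (L (inv a) z)"
  using assms by (simp add: star_eq_L minus_diff)

lemma star_conj:
  assumes "a \<in> carrier B" "c \<in> carrier B" "z \<in> carrier B"
  shows "star (c \<otimes> a \<otimes> inv c) z = L c (star a (L (inv c) z))"
  using assms by (simp add: star_eq_L L_mult L_diff)

text \<open>Conjugation and \<open>L c\<close> differ by an error term involving \<open>star\<close>. So invariance
  under one can be exchanged for invariance under the other wherever that error is negligible.\<close>

lemma conj_eq_L_add: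
  assumes "a \<in> carrier B" "c \<in> carrier B"
  shows "c \<otimes> a \<otimes> inv c = L c a \<oplus> L c (star a (inv c))"
proof -
  have "c \<otimes> a \<otimes> inv c = c \<otimes> (a \<oplus> L a (inv c))"
    using assms by (simp add: m_assoc mult_eq_add_L[of a])
  also have "\<dots> = c \<oplus> (L c a \<oplus> L c (L a (inv c)))"
    using assms by (simp add: mult_eq_add_L L_add)
  also have "L a (inv c) = star a (inv c) \<oplus> inv c"
    using assms by (simp add: star_eq_L minus_eq a_assoc l_neg)
  also have "c \<oplus> (L c a \<oplus> L c (star a (inv c) \<oplus> inv c)) = L c a \<oplus> L c (star a (inv c))"
    using assms by (simp add: L_add L_inv_self a_ac r_neg1 r_neg2 r_neg)
  finally show ?thesis .
qed

section \<open>The associated solution\<close>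

lemma bij_betw_L: "a \<in> carrier B \<Longrightarrow> bij_betw (L a) (carrier B) (carrier B)"
  by (rule bij_betw_byWitness[where f' = "L (inv a)"]) auto

lemma inv_into_L:
  assumes "a \<in> carrier B" "b \<in> carrier B"
  shows "inv_into (carrier B) (L a) b = L (inv a) b"
  using assms bij_betw_L[of a] by (intro inv_into_f_eq) (auto simp: bij_betw_def)

text \<open>The second component of the solution. Written with inverses instead of the inverse map of
  \<open>L\<close>, it is visibly a right action that is bijective in the argument \<open>a\<close>.\<close>

definition R :: "'a \<Rightarrow> 'a \<Rightarrow> 'a" where
  "R a b = inv (L (inv b) (inv a))"

lemma R_closed [simp]: "a \<in> carrier B \<Longrightarrow> b \<in> carrier B \<Longrightarrow> R a b \<in> carrier B"
  by (simp add: R_def)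

lemma R_one: "a \<in> carrier B \<Longrightarrow> R a \<one> = a"
  by (simp add: R_def)

lemma R_mult:
  assumes "a \<in> carrier B" "b \<in> carrier B" "c \<in> carrier B"
  shows "R a (b \<otimes> c) = R (R a b) c"
  using assms by (simp add: R_def inv_mult_group L_mult)

text \<open>The map of the solution preserves products, because \<open>b\<cdot>L\<^bsub>b\<inverse>\<^esub>(a\<inverse>) = b + a\<inverse> = a\<inverse>\<cdot>L\<^sub>a(b)\<close>.\<close>

lemma L_mult_R:
  assumes "a \<in> carrier B" "b \<in> carrier B"
  shows "L a b \<otimes> R a b = a \<otimes> b"
proof -
  have "b \<otimes> L (inv b) (inv a) = b \<oplus> inv a"
    using assms by (simp add: add_eq_mult_L)
  also have "\<dots> = inv a \<otimes> L a b"
    using assms by (simp add: mult_eq_add_L a_comm)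
  finally have "L (inv b) (inv a) = inv b \<otimes> (inv a \<otimes> L a b)"
    using assms by (metis inv_solve_left L_closed inv_closed m_closed)
  then have "R a b = inv (L a b) \<otimes> (a \<otimes> b)"
    using assms by (simp add: R_def inv_mult_group m_assoc)
  then show ?thesis using assms by (simp add: m_assoc[symmetric])
qed

lemma L_L_R:
  assumes "a \<in> carrier B" "b \<in> carrier B"
  shows "L (L a b) (R a b) = a"
proof -
  have "L a b \<oplus> L (L a b) (R a b) = L a b \<oplus> a"
    using L_mult_R[OF assms] assms by (simp add: mult_eq_add_L a_comm)
  then show ?thesis using assms by simp
qed

lemma R_eq:
  assumes "a \<in> carrier B" "b \<in> carrier B"
  shows "R a b = L (inv (L a b)) a"
  using assms L_L_R[OF assms] L_inv(1)[of "L a b" "R a b"] by simp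

lemma R_L_R:
  assumes "a \<in> carrier B" "b \<in> carrier B"
  shows "R (L a b) (R a b) = b"
  using assms by (simp add: R_eq[of "L a b"] L_L_R)

lemma snd_brace_solution:
  assumes "a \<in> carrier B" "b \<in> carrier B"
  shows "snd (brace_solution B) (a, b) = (L a b, R a b)"
  using assms by (simp add: brace_solution_def inv_into_L R_eq)

lemma fst_brace_solution: "fst (brace_solution B) = carrier B"
  by (simp add: brace_solution_def)

lemma bij_betw_R:
  assumes "b \<in> carrier B"
  shows "bij_betw (\<lambda>a. R a b) (carrier B) (carrier B)"
  by (rule bij_betw_byWitness[where f' = "\<lambda>a. R a (inv b)"])
    (use assms in \<open>auto simp: R_mult[symmetric] R_one\<close>)

text \<open>The outer components agree since \<open>L\<close> is a left action, \<open>R\<close> is a right action and products are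
  preserved. Both sides then have the same total product \<open>a\<cdot>b\<cdot>c\<close>, so cancelling the outer
  components gives the middle one.\<close>

lemma braid_relation:
  assumes "a \<in> carrier B" "b \<in> carrier B" "c \<in> carrier B"
  shows "L (L a b) (L (R a b) c) = L a (L b c)"
    and "R (L a b) (L (R a b) c) = L (R a (L b c)) (R b c)"
    and "R (R a b) c = R (R a (L b c)) (R b c)"
proof -
  show 1: "L (L a b) (L (R a b) c) = L a (L b c)"
    using assms by (simp add: L_mult[symmetric] L_mult_R)
  show 3: "R (R a b) c = R (R a (L b c)) (R b c)"
    using assms by (simp add: R_mult[symmetric] L_mult_R)
  let ?x = "L a (L b c)" and ?z = "R (R a b) c"
  have "?x \<otimes> R (L a b) (L (R a b) c) \<otimes> ?z = L a b \<otimes> L (R a b) c \<otimes> ?z"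
    using assms L_mult_R[of "L a b" "L (R a b) c"] by (simp add: 1)
  also have "\<dots> = L a b \<otimes> (R a b \<otimes> c)"
    using assms by (simp add: m_assoc L_mult_R)
  also have "\<dots> = a \<otimes> b \<otimes> c"
    using assms by (simp add: L_mult_R m_assoc[symmetric])
  also have "\<dots> = a \<otimes> (L b c \<otimes> R b c)"
    using assms by (simp add: L_mult_R m_assoc)
  also have "\<dots> = a \<otimes> L b c \<otimes> R b c"
    using assms by (simp add: m_assoc)
  also have "\<dots> = ?x \<otimes> R a (L b c) \<otimes> R b c"
    using assms L_mult_R[of a "L b c"] by simp
  also have "\<dots> = ?x \<otimes> (R a (L b c) \<otimes> R b c)"
    using assms by (simp add: m_assoc)
  also have "\<dots> = ?x \<otimes> L (R a (L b c)) (R b c) \<otimes> ?z"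
    using assms L_mult_R[of "R a (L b c)" "R b c"] by (simp add: 3 m_assoc)
  finally show "R (L a b) (L (R a b) c) = L (R a (L b c)) (R b c)"
    using assms by simp
qed

theorem yb_solution_brace_solution: "yb_solution (brace_solution B)"
proof -
  let ?r = "snd (brace_solution B)"
  have left: "bij_betw (\<lambda>y. fst (?r (x, y))) (carrier B) (carrier B)"
    if "x \<in> carrier B" for x
    using bij_betw_L[OF that] by (rule bij_betw_cong[THEN iffD1, rotated])
      (simp add: snd_brace_solution that)
  have right: "bij_betw (\<lambda>y. snd (?r (y, x))) (carrier B) (carrier B)"
    if "x \<in> carrier B" for x
    using bij_betw_R[OF that] by (rule bij_betw_cong[THEN iffD1, rotated])
      (simp add: snd_brace_solution that)
  have "yb_solution (carrier B, ?r)"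
    unfolding yb_solution_def prod.case
  proof (intro conjI ballI)
    show "carrier B \<noteq> {}" using one_closed by blast
    show "?r \<in> carrier B \<times> carrier B \<rightarrow> carrier B \<times> carrier B"
      by (auto simp: snd_brace_solution)
    show "r12 ?r (r23 ?r (r12 ?r t)) = r23 ?r (r12 ?r (r23 ?r t))"
      if "t \<in> carrier B \<times> carrier B \<times> carrier B" for t
    proof -
      obtain a b c where t: "t = (a, b, c)" "a \<in> carrier B" "b \<in> carrier B" "c \<in> carrier B"
        using \<open>t \<in> _\<close> by auto
      show ?thesis
        using t braid_relation[OF t(2-4)] by (simp add: snd_brace_solution r12_def r23_def)
    qed
    show "?r (?r p) = p" if "p \<in> carrier B \<times> carrier B" for p
      using that by (auto simp: snd_brace_solution L_L_R R_L_R)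
  qed (use left right in auto)
  then show ?thesis by (simp add: brace_solution_def)
qed

section \<open>Ideals and the socle series\<close>

text \<open>In the usual definition an ideal is normal in the multiplicative group. For a subgroup
  invariant under all \<open>L c\<close> this is the same as the last clause, by \<open>conj_eq_L_add\<close>.\<close>

definition brace_ideal :: "'a set \<Rightarrow> bool" where
  "brace_ideal I \<longleftrightarrow> subgroup I (add_monoid B) \<and>
     (\<forall>c \<in> carrier B. \<forall>a \<in> I. L c a \<in> I) \<and> (\<forall>a \<in> I. \<forall>c \<in> carrier B. star a c \<in> I)"

text \<open>For an ideal \<open>I\<close>, the preimage in \<open>B\<close> of the socle of the quotient brace \<open>B/I\<close>.\<close>

definition socle_over :: "'a set \<Rightarrow> 'a set" where
  "socle_over I = {a \<in> carrier B. \<forall>z \<in> carrier B. star a z \<in> I}"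

primrec socle_series :: "nat \<Rightarrow> 'a set" where
  "socle_series 0 = {\<zero>}"
| "socle_series (Suc k) = socle_over (socle_series k)"

context
  fixes I
  assumes I: "brace_ideal I"
begin

lemma ideal_subset: "a \<in> I \<Longrightarrow> a \<in> carrier B"
  using I by (auto simp: brace_ideal_def dest!: subgroup.subset)

lemma ideal_zero: "\<zero> \<in> I"
  using I by (auto simp: brace_ideal_def dest: subgroup.one_closed)

lemma ideal_add: "a \<in> I \<Longrightarrow> b \<in> I \<Longrightarrow> a \<oplus> b \<in> I"
  using I by (auto simp: brace_ideal_def dest: subgroup.m_closed)

lemma ideal_minus: "a \<in> I \<Longrightarrow> \<ominus> a \<in> I"
  using I subgroup.m_inv_closed[of I "add_monoid B" a] by (auto simp: brace_ideal_def a_inv_def)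

lemma ideal_L: "c \<in> carrier B \<Longrightarrow> a \<in> I \<Longrightarrow> L c a \<in> I"
  using I by (auto simp: brace_ideal_def)

lemma ideal_star: "a \<in> I \<Longrightarrow> c \<in> carrier B \<Longrightarrow> star a c \<in> I"
  using I by (auto simp: brace_ideal_def)

lemma ideal_L_iff: "c \<in> carrier B \<Longrightarrow> a \<in> carrier B \<Longrightarrow> L c a \<in> I \<longleftrightarrow> a \<in> I"
  using ideal_L[of c a] ideal_L[of "inv c" "L c a"] by auto

lemma ideal_diff_trans:
  assumes "a \<in> carrier B" "b \<in> carrier B" "c \<in> carrier B" "a \<ominus> b \<in> I" "b \<ominus> c \<in> I"
  shows "a \<ominus> c \<in> I"
  using ideal_add[OF assms(4,5)] assms by (simp add: diff_add_diff)

lemma ideal_diff_sym: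
  assumes "a \<in> carrier B" "b \<in> carrier B" "a \<ominus> b \<in> I"
  shows "b \<ominus> a \<in> I"
  using ideal_minus[OF assms(3)] assms by (simp add: minus_diff)

lemma ideal_subset_socle_over: "I \<subseteq> socle_over I"
  by (auto simp: socle_over_def ideal_subset ideal_star)

text \<open>As the kernel of the action of \<open>(B,\<cdot>)\<close> on \<open>B/I\<close> by \<open>L\<close>, the set \<open>socle_over I\<close> is a normal
  subgroup for multiplication. It contains \<open>I\<close>, and so absorbs the error term by which conjugation
  differs from \<open>L c\<close>; therefore it is invariant under \<open>L c\<close>, and then additive closure follows
  from multiplicative closure.\<close>

lemma brace_ideal_socle_over: "brace_ideal (socle_over I)"
proof -
  let ?J = "socle_over I"
  have sub: "a \<in> carrier B" if "a \<in> ?J" for a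
    using that by (simp add: socle_over_def)
  have mult: "a \<otimes> b \<in> ?J" if "a \<in> ?J" "b \<in> ?J" for a b
    using that by (simp add: socle_over_def star_mult ideal_add)
  have minv: "inv a \<in> ?J" if "a \<in> ?J" for a
    using that by (simp add: socle_over_def star_inv ideal_minus)
  have conj: "c \<otimes> a \<otimes> inv c \<in> ?J" if "a \<in> ?J" "c \<in> carrier B" for a c
    using that by (simp add: socle_over_def star_conj ideal_L)
  have add_I: "a \<oplus> i \<in> ?J" if "a \<in> ?J" "i \<in> I" for a i
    using that mult[of a "L (inv a) i"] ideal_L[of "inv a" i] ideal_subset_socle_over
    by (auto simp: add_eq_mult_L sub ideal_subset)
  have L: "L c a \<in> ?J" if a: "a \<in> ?J" and c: "c \<in> carrier B" for a c
  proof -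
    let ?i = "L c (star a (inv c))"
    have i: "?i \<in> I" using a c by (simp add: socle_over_def ideal_L)
    have "L c a = c \<otimes> a \<otimes> inv c \<oplus> (\<ominus> ?i)"
      using a c by (simp add: conj_eq_L_add sub a_assoc r_neg)
    then show ?thesis
      using add_I[OF conj[OF a c] ideal_minus[OF i]] by simp
  qed
  have add: "a \<oplus> b \<in> ?J" if "a \<in> ?J" "b \<in> ?J" for a b
    using that by (simp add: add_eq_mult_L sub mult L)
  have minus: "\<ominus> a \<in> ?J" if "a \<in> ?J" for a
    using L[OF minv[OF that] sub[OF that]] that by (simp add: L_inv_self sub)
  have "subgroup ?J (add_monoid B)"
    by (rule group.subgroupI[OF a_group])
      (use sub add minus ideal_zero ideal_subset_socle_over in \<open>auto simp: a_inv_def\<close>)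
  moreover have "star a c \<in> ?J" if "a \<in> ?J" "c \<in> carrier B" for a c
    using that ideal_subset_socle_over by (auto simp: socle_over_def)
  ultimately show ?thesis
    using L by (simp add: brace_ideal_def)
qed

end

context
  fixes I
  assumes I: "brace_ideal I"
begin

text \<open>With \<open>a = b\<cdot>s\<close>, both sides say \<open>s \<in> socle_over I\<close>: the left one since
  \<open>L\<^sub>a(z) - L\<^sub>b(z) = L\<^sub>b(s * z)\<close>, the right one since \<open>a - b = L\<^sub>b(s)\<close>.\<close>

lemma L_diff_in_ideal_iff:
  assumes "a \<in> carrier B" "b \<in> carrier B"
  shows "(\<forall>z \<in> carrier B. L a z \<ominus> L b z \<in> I) \<longleftrightarrow> a \<ominus> b \<in> socle_over I"
proof -
  define s where "s = inv b \<otimes> a"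
  have s: "s \<in> carrier B" "a = b \<otimes> s"
    using assms by (simp_all add: s_def m_assoc[symmetric])
  have "L a z \<ominus> L b z = L b (star s z)" if "z \<in> carrier B" for z
    using that assms s by (simp add: L_mult star_eq_L L_diff)
  then have "(\<forall>z \<in> carrier B. L a z \<ominus> L b z \<in> I) \<longleftrightarrow> s \<in> socle_over I"
    using assms s by (simp add: socle_over_def ideal_L_iff[OF I])
  also have "\<dots> \<longleftrightarrow> L b s \<in> socle_over I"
    using assms s by (simp add: ideal_L_iff[OF brace_ideal_socle_over[OF I]])
  also have "L b s = a \<ominus> b"
    using assms s by (simp add: brace_L_def)
  finally show ?thesis .
qed

lemma L_cong_ideal:
  assumes "a \<in> carrier B" "a' \<in> carrier B" "b \<in> carrier B" "b' \<in> carrier B"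
    and "a \<ominus> a' \<in> I" "b \<ominus> b' \<in> I"
  shows "L a b \<ominus> L a' b' \<in> I"
proof (rule ideal_diff_trans[OF I])
  have "a \<ominus> a' \<in> socle_over I" using assms(5) ideal_subset_socle_over[OF I] by auto
  then show "L a b \<ominus> L a' b \<in> I"
    using L_diff_in_ideal_iff assms by blast
  show "L a' b \<ominus> L a' b' \<in> I"
    using assms ideal_L[OF I, of a' "b \<ominus> b'"] by (simp add: L_diff)
qed (use assms in auto)

text \<open>Applying \<open>L a\<close> reduces the claim to additive inverses, since \<open>L\<^sub>a(a\<inverse>) = -a\<close> while
  \<open>L\<^sub>a(a'\<inverse>)\<close> is congruent to \<open>L\<^bsub>a'\<^esub>(a'\<inverse>) = -a'\<close>.\<close>

lemma inv_cong_ideal: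
  assumes "a \<in> carrier B" "a' \<in> carrier B" "a \<ominus> a' \<in> I"
  shows "inv a \<ominus> inv a' \<in> I"
proof -
  have "\<ominus> a \<ominus> \<ominus> a' = a' \<ominus> a"
    using assms by (simp add: minus_eq a_comm)
  then have "\<ominus> a \<ominus> \<ominus> a' \<in> I"
    using ideal_diff_sym[OF I] assms by simp
  moreover have "\<ominus> a' \<ominus> L a (inv a') \<in> I"
    using L_cong_ideal[of a' a "inv a'" "inv a'"] ideal_diff_sym[OF I, of a a'] ideal_zero[OF I] assms
    by (simp add: L_inv_self)
  ultimately have "L a (inv a \<ominus> inv a') \<in> I"
    using ideal_diff_trans[OF I, of "\<ominus> a" "\<ominus> a'" "L a (inv a')"] assms
    by (simp add: L_diff L_inv_self)
  then show ?thesis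
    using assms by (simp add: ideal_L_iff[OF I])
qed

lemma R_cong_ideal:
  assumes "a \<in> carrier B" "a' \<in> carrier B" "b \<in> carrier B" "b' \<in> carrier B"
    and "a \<ominus> a' \<in> I" "b \<ominus> b' \<in> I"
  shows "R a b \<ominus> R a' b' \<in> I"
  unfolding R_def using assms by (intro inv_cong_ideal L_cong_ideal) auto

end

section \<open>Retractions of the associated solution\<close>

lemma brace_ideal_socle_series: "brace_ideal (socle_series k)"
proof (induction k)
  case 0
  have "subgroup {\<zero>} (add_monoid B)"
    using group.triv_subgroup[OF a_group] by simp
  then show ?case by (auto simp: brace_ideal_def star_eq_L)
qed (simp add: brace_ideal_socle_over)

lemma socle_series_mono: "socle_series k \<subseteq> socle_series (Suc k)"
  using ideal_subset_socle_over[OF brace_ideal_socle_series] by simp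

definition socle_coset :: "nat \<Rightarrow> 'a \<Rightarrow> 'a set" where
  "socle_coset k x = {y \<in> carrier B. y \<ominus> x \<in> socle_series k}"

lemma in_socle_coset_self: "x \<in> carrier B \<Longrightarrow> x \<in> socle_coset k x"
  by (simp add: socle_coset_def ideal_zero[OF brace_ideal_socle_series])

lemma socle_coset_eq_iff:
  assumes "x \<in> carrier B" "y \<in> carrier B"
  shows "socle_coset k x = socle_coset k y \<longleftrightarrow> x \<ominus> y \<in> socle_series k"
proof
  assume "socle_coset k x = socle_coset k y"
  then show "x \<ominus> y \<in> socle_series k"
    using in_socle_coset_self[OF assms(1), of k] by (simp add: socle_coset_def)
next
  note tr = ideal_diff_trans[OF brace_ideal_socle_series[of k]]
  assume xy: "x \<ominus> y \<in> socle_series k"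
  then have yx: "y \<ominus> x \<in> socle_series k"
    using ideal_diff_sym[OF brace_ideal_socle_series] assms by blast
  show "socle_coset k x = socle_coset k y"
    unfolding socle_coset_def using assms tr[OF _ _ _ _ xy] tr[OF _ _ _ _ yx] by blast
qed

text \<open>Retracting the cosets of \<open>Soc\<^sub>k\<close> groups them into classes of cosets, and the relabelling by
  unions turns such a class into one coset of \<open>Soc\<^sub>k\<^sub>+\<^sub>1\<close>.\<close>

lemma Union_socle_cosets:
  assumes "x \<in> carrier B"
  shows "\<Union> (socle_coset k ` socle_coset (Suc k) x) = socle_coset (Suc k) x"
proof
  show "socle_coset (Suc k) x \<subseteq> \<Union> (socle_coset k ` socle_coset (Suc k) x)"
    using in_socle_coset_self by (auto simp: socle_coset_def)
  show "\<Union> (socle_coset k ` socle_coset (Suc k) x) \<subseteq> socle_coset (Suc k) x"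
  proof
    fix z assume "z \<in> \<Union> (socle_coset k ` socle_coset (Suc k) x)"
    then obtain y where "y \<in> carrier B" "y \<ominus> x \<in> socle_series (Suc k)"
      "z \<in> carrier B" "z \<ominus> y \<in> socle_series k"
      by (auto simp: socle_coset_def simp del: socle_series.simps)
    then show "z \<in> socle_coset (Suc k) x"
      unfolding socle_coset_def
      using ideal_diff_trans[OF brace_ideal_socle_series[of "Suc k"], of z y x]
        socle_series_mono[of k] assms by blast
  qed
qed

text \<open>The map must be carried along in the induction, since it determines the next retraction
  relation. That it is well defined on classes is the congruence property of \<open>L\<close> and \<open>R\<close> modulo
  an ideal.\<close>

lemma Ret_pow_brace_solution:
  shows "fst (Ret_pow k (brace_solution B)) = socle_coset k ` carrier B"
    and "\<lbrakk>x \<in> carrier B; y \<in> carrier B\<rbrakk> \<Longrightarrow>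
      snd (Ret_pow k (brace_solution B)) (socle_coset k x, socle_coset k y)
        = (socle_coset k (L x y), socle_coset k (R x y))"
proof (induction k arbitrary: x y)
  case 0
  have single: "socle_coset 0 x = {x}" if "x \<in> carrier B" for x
    using that by (auto simp: socle_coset_def diff_eq_zero_iff)
  { case 1
    show ?case by (auto simp: fst_brace_solution single) }
  { case 2
    then show ?case
      using transport_iso[of "\<lambda>x. {x}" "brace_solution B" x y]
      by (simp add: fst_brace_solution single snd_brace_solution) }
next
  case (Suc k)
  let ?P = "Ret_pow k (brace_solution B)"
  let ?c = "\<lambda>x. ret_class ?P (socle_coset k x)"
  note I = brace_ideal_socle_series
  note [simp del] = socle_series.simps(2)
  have P: "?P = (socle_coset k ` carrier B, snd ?P)"
    using Suc.IH(1) by (metis prod.collapse)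
  have rel: "(socle_coset k x, socle_coset k y) \<in> ret_rel ?P \<longleftrightarrow> x \<ominus> y \<in> socle_series (Suc k)"
    if "x \<in> carrier B" "y \<in> carrier B" for x y
    unfolding ret_rel_def
    by (subst P) (use that Suc.IH(2) in
      \<open>simp add: socle_coset_eq_iff L_diff_in_ideal_iff[OF I] socle_series.simps(2)\<close>)
  have rel_sub: "ret_rel ?P `` {U} \<subseteq> socle_coset k ` carrier B" for U
    unfolding ret_rel_def by (subst P) auto
  have cls: "?c x = socle_coset k ` socle_coset (Suc k) x" if x: "x \<in> carrier B" for x
  proof -
    have "?c x = socle_coset k ` {y \<in> carrier B. x \<ominus> y \<in> socle_series (Suc k)}"
      unfolding ret_class_def
    proof (intro equalityI subsetI)
      fix U assume U: "U \<in> ret_rel ?P `` {socle_coset k x}"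
      then obtain y where "y \<in> carrier B" "U = socle_coset k y" using rel_sub by blast
      then show "U \<in> socle_coset k ` {y \<in> carrier B. x \<ominus> y \<in> socle_series (Suc k)}"
        using U rel[OF x] by auto
    qed (use rel[OF x] in auto)
    also have "{y \<in> carrier B. x \<ominus> y \<in> socle_series (Suc k)} = socle_coset (Suc k) x"
      unfolding socle_coset_def using x ideal_diff_sym[OF I[of "Suc k"]] by blast
    finally show ?thesis .
  qed
  have Un: "\<Union> (?c x) = socle_coset (Suc k) x" if "x \<in> carrier B" for x
    using that by (simp add: cls Union_socle_cosets)
  have c_eq: "?c x = ?c y"
    if "x \<in> carrier B" "y \<in> carrier B" "x \<ominus> y \<in> socle_series (Suc k)" for x y
    using that socle_coset_eq_iff[of x y "Suc k"] by (simp add: cls)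
  have fst: "fst (Ret ?P) = ?c ` carrier B"
    unfolding fst_Ret Suc.IH(1) by (auto simp: quotient_def ret_class_def)
  have snd: "snd (Ret ?P) (?c x, ?c y) = (?c (L x y), ?c (R x y))"
    if xy: "x \<in> carrier B" "y \<in> carrier B" for x y
  proof -
    let ?f = "\<lambda>p. map_prod (ret_class ?P) (ret_class ?P) (snd ?P p)"
    \<comment> \<open>All representatives give the same pair of classes, so the image under \<open>the_elem\<close> in
      the definition of \<^const>\<open>Ret\<close> is a singleton.\<close>
    have mem: "(socle_coset k x, socle_coset k y) \<in> ?c x \<times> ?c y"
      using xy in_socle_coset_self by (auto simp: cls)
    have const: "?f p = (?c (L x y), ?c (R x y))" if p: "p \<in> ?c x \<times> ?c y" for p
    proof -
      obtain x' y' where p: "p = (socle_coset k x', socle_coset k y')"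
        and x': "x' \<in> carrier B" "x' \<ominus> x \<in> socle_series (Suc k)"
        and y': "y' \<in> carrier B" "y' \<ominus> y \<in> socle_series (Suc k)"
        using p unfolding cls[OF xy(1)] cls[OF xy(2)] socle_coset_def[of "Suc k"] by blast
      then show ?thesis
        using xy Suc.IH(2) c_eq L_cong_ideal[OF I] R_cong_ideal[OF I] by simp
    qed
    have "?f ` (?c x \<times> ?c y) = (\<lambda>_. (?c (L x y), ?c (R x y))) ` (?c x \<times> ?c y)"
      by (rule image_cong[OF refl const])
    also have "\<dots> = {(?c (L x y), ?c (R x y))}"
      by (rule image_constant[OF mem])
    finally show ?thesis by (simp add: Ret_def split_beta)
  qed
  { case 1
    show ?case by (simp add: fst image_image Un cong: image_cong) }
  { case 2
    have "snd (Ret_pow (Suc k) (brace_solution B)) (\<Union> (?c x), \<Union> (?c y))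
        = map_prod Union Union (snd (Ret ?P) (?c x, ?c y))"
      unfolding Ret_pow.simps using 2 by (intro transport_iso inj_on_Union_Ret_pow) (auto simp: fst)
    also have "\<dots> = (socle_coset (Suc k) (L x y), socle_coset (Suc k) (R x y))"
      using 2 by (simp add: snd Un)
    finally show ?case using 2 by (simp only: Un) }
qed

lemma card_Ret_pow_brace_solution:
  "card (fst (Ret_pow k (brace_solution B))) = 1 \<longleftrightarrow> carrier B \<subseteq> socle_series k"
proof
  assume "card (fst (Ret_pow k (brace_solution B))) = 1"
  then obtain c where c: "socle_coset k ` carrier B = {c}"
    unfolding Ret_pow_brace_solution(1) by (rule card_1_singletonE)
  show "carrier B \<subseteq> socle_series k"
  proof
    fix x assume x: "x \<in> carrier B"
    then have "socle_coset k x = socle_coset k \<zero>"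
      using c zero_closed by blast
    then show "x \<in> socle_series k"
      using x socle_coset_eq_iff[of x \<zero> k] by simp
  qed
next
  assume "carrier B \<subseteq> socle_series k"
  then have "socle_coset k x = socle_coset k \<zero>" if "x \<in> carrier B" for x
    using that socle_coset_eq_iff[of x \<zero> k] by auto
  then have "socle_coset k ` carrier B = {socle_coset k \<zero>}"
    using zero_closed by blast
  then show "card (fst (Ret_pow k (brace_solution B))) = 1"
    by (simp add: Ret_pow_brace_solution(1))
qed

section \<open>Rump's chain\<close>

lemma rump_chain_closed: "rump_chain B n \<subseteq> carrier B"
proof (induction n rule: induct_nat_012)
  case (ge2 n)
  have "generate (add_monoid B) {star u v | u v. u \<in> rump_chain B (Suc n) \<and> v \<in> carrier B}
      \<subseteq> carrier (add_monoid B)"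
    using ge2 by (intro group.generate_incl[OF a_group]) auto
  then show ?case by (simp add: star_subgroup_def)
qed auto

lemma star_subgroup_subset_iff:
  assumes "brace_ideal I" "U \<subseteq> carrier B"
  shows "star_subgroup B U (carrier B) \<subseteq> I \<longleftrightarrow> U \<subseteq> socle_over I"
proof -
  let ?S = "{star u v | u v. u \<in> U \<and> v \<in> carrier B}"
  have "star_subgroup B U (carrier B) \<subseteq> I \<longleftrightarrow> ?S \<subseteq> I"
  proof
    show "?S \<subseteq> I" if "star_subgroup B U (carrier B) \<subseteq> I"
      using that generate.incl[of _ ?S "add_monoid B"] unfolding star_subgroup_def by blast
    show "star_subgroup B U (carrier B) \<subseteq> I" if "?S \<subseteq> I"
      using group.generate_subgroup_incl[OF a_group that] assms(1)
      by (simp add: star_subgroup_def brace_ideal_def)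
  qed
  also have "\<dots> \<longleftrightarrow> U \<subseteq> socle_over I"
    using assms(2) by (auto simp: socle_over_def)
  finally show ?thesis .
qed

text \<open>Each step trades one factor \<open>B\<close> on the left for one step of the socle series on the
  right.\<close>

lemma rump_chain_subset_socle_series:
  "rump_chain B (Suc j + k) \<subseteq> socle_series i \<longleftrightarrow> rump_chain B (Suc j) \<subseteq> socle_series (i + k)"
proof (induction k arbitrary: i)
  case (Suc k)
  have "rump_chain B (Suc j + Suc k) \<subseteq> socle_series i
      \<longleftrightarrow> rump_chain B (Suc j + k) \<subseteq> socle_series (Suc i)"
    using star_subgroup_subset_iff[OF brace_ideal_socle_series rump_chain_closed] by simp
  then show ?case using Suc[of "Suc i"] by simp
qed simp

lemma zero_in_rump_chain: "\<zero> \<in> rump_chain B n"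
  using generate.one[of "add_monoid B"]
  by (induction n rule: induct_nat_012) (auto simp: star_subgroup_def)

lemma rump_chain_eq_zero_iff: "rump_chain B (Suc k) = {\<zero>} \<longleftrightarrow> carrier B \<subseteq> socle_series k"
  using rump_chain_subset_socle_series[of 0 k 0] zero_in_rump_chain[of "Suc k"] by auto

end

theorem proposition5:
  fixes B :: "('a, 'b) ring_scheme" and m :: nat
  assumes "left_brace B"
    and "carrier B \<noteq> {\<zero>\<^bsub>B\<^esub>}"
    and "m > 0"
  shows "mpl_is (brace_solution B) m \<longleftrightarrow>
    rump_chain B (m + 1) = {\<zero>\<^bsub>B\<^esub>} \<and> rump_chain B m \<noteq> {\<zero>\<^bsub>B\<^esub>}"
proof -
  interpret left_brace B by (rule assms(1))
  obtain n where m: "m = Suc n" using assms(3) gr0_implies_Suc by blast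
  \<comment> \<open>The series increases, so minimality of the level only has to be tested one step below.\<close>
  have mono: "socle_series k \<subseteq> socle_series n" if "k \<le> n" for k
    by (rule lift_Suc_mono_le[of socle_series, OF socle_series_mono that])
  have "mpl_is (brace_solution B) m \<longleftrightarrow>
      carrier B \<subseteq> socle_series m \<and> (\<forall>k \<le> n. \<not> carrier B \<subseteq> socle_series k)"
    unfolding mpl_is_def card_Ret_pow_brace_solution m less_Suc_eq_le
    using yb_solution_brace_solution by blast
  also have "\<dots> \<longleftrightarrow> carrier B \<subseteq> socle_series m \<and> \<not> carrier B \<subseteq> socle_series n"
    using mono by blast
  also have "\<dots> \<longleftrightarrow> rump_chain B (m + 1) = {\<zero>\<^bsub>B\<^esub>} \<and> rump_chain B m \<noteq> {\<zero>\<^bsub>B\<^esub>}"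
    using rump_chain_eq_zero_iff[of m] rump_chain_eq_zero_iff[of n] m by simp
  finally show ?thesis .
qed

end
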